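(* Let $\mathcal G=\langle G,h,g\rangle$ be a winning hat guessing game on a finite directed graph $G$, and let $\vec{uv}$ be a directed edge of $G$. Let $G'$ be obtained from $G$ by removing only the directed edge $\vec{uv}$; the edge $\vec{vu}$, if present, is kept. Define $g'(x)=g(x)$ for $x\neq u$ and $g'(u)=g(u)h(v)$. Then the game $\langle G',h,g'\rangle$ is winning.
   Context: Hat guessing game $\langle G,h,g\rangle$ on a directed graph $G$ with $h,g\colon V(G)\to\mathbb N$. A directed edge $\vec{uv}$ means $u$ sees $v$; an undirected graph is viewed as having both directions of each edge. The adversary gives each vertex $v$ a color in $\{0,\dots,h(v)-1\}$. Each vertex $x$ sees only the colors of its out-neighbors and names at most $g(x)$ colors via a deterministic strategy fixed in advance that depends only on those colors. The game is winning if some strategy ensures that for every assignment some vertex names its own color. *)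

theory Defs
  imports "Graph_Theory.Pair_Digraph" "HOL-Library.FuncSet"
begin

type_synonym 'a coloring = "'a \<Rightarrow> nat"

definition out_neighbors :: "'a pair_pre_digraph \<Rightarrow> 'a \<Rightarrow> 'a set" where
  "out_neighbors G x = {y. (x, y) \<in> parcs G}"

definition colorings :: "('a \<Rightarrow> nat) \<Rightarrow> 'a set \<Rightarrow> 'a coloring set" where
  "colorings h S = (\<Pi>\<^sub>E v\<in>S. {..<h v})"

text \<open>The guess of \<open>x\<close> is a function of the coloring of its out-neighbors alone,
  so the strategy cannot depend on any other color.\<close>

definition is_strategy ::
  "'a pair_pre_digraph \<Rightarrow> ('a \<Rightarrow> nat) \<Rightarrow> ('a \<Rightarrow> nat) \<Rightarrow> ('a \<Rightarrow> 'a coloring \<Rightarrow> nat set) \<Rightarrow> bool" where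
  "is_strategy G h g f \<longleftrightarrow>
     (\<forall>x\<in>pverts G. \<forall>s\<in>colorings h (out_neighbors G x).
        f x s \<subseteq> {..<h x} \<and> card (f x s) \<le> g x)"

definition winning_game ::
  "'a pair_pre_digraph \<Rightarrow> ('a \<Rightarrow> nat) \<Rightarrow> ('a \<Rightarrow> nat) \<Rightarrow> bool" where
  "winning_game G h g \<longleftrightarrow>
     (\<exists>f. is_strategy G h g f \<and>
        (\<forall>c\<in>colorings h (pverts G).
           \<exists>x\<in>pverts G. c x \<in> f x (restrict c (out_neighbors G x))))"

definition remove_arc :: "'a pair_pre_digraph \<Rightarrow> 'a \<Rightarrow> 'a \<Rightarrow> 'a pair_pre_digraph" where
  "remove_arc G u v = G\<lparr>parcs := parcs G - {(u, v)}\<rparr>"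

end

theory Submission
  imports Defs
begin

text \<open>Having lost sight of \<open>v\<close>, the vertex \<open>u\<close> can still run its old
  strategy once for each of the \<open>h v\<close> possible colors of \<open>v\<close> and name
  everything that comes out: at most \<open>g u\<close> colors per run, hence at most
  \<open>g u * h v\<close> in all. The true color of \<open>v\<close> is among those tried, so
  \<open>u\<close> names at least what it named before, and every other vertex sees and names the
  same as before. Whichever vertex was right under the old strategy is therefore still
  right.\<close>

lemma pverts_remove_arc [simp]: "pverts (remove_arc G u v) = pverts G"
  by (simp add: remove_arc_def)

lemma out_neighbors_remove_arc:
  "out_neighbors (remove_arc G u v) x =
     (if x = u then out_neighbors G u - {v} else out_neighbors G x)"
  by (auto simp: remove_arc_def out_neighbors_def)

text \<open>Turns a view of \<open>u\<close> in the smaller graph, completed by a hypothetical color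
  of \<open>v\<close>, into a legitimate view in \<open>G\<close>; \<open>is_strategy\<close> bounds
  the guesses only on such views.\<close>

lemma colorings_fun_upd:
  assumes "s \<in> colorings h (S - {v})" "v \<in> S" "k < h v"
  shows "s(v := k) \<in> colorings h S"
  using assms by (auto simp: colorings_def PiE_iff extensional_def)

theorem theorem2p8:
  fixes G :: "'a pair_pre_digraph" and h g :: "'a \<Rightarrow> nat" and u v :: 'a
  assumes "pair_fin_digraph G"
    and "(u, v) \<in> parcs G"
    and "winning_game G h g"
  shows "winning_game (remove_arc G u v) h (g(u := g u * h v))"
proof -
  interpret pair_fin_digraph G by fact
  have v: "v \<in> pverts G" "v \<in> out_neighbors G u"
    using assms(2) in_arcsD2 by (auto simp: out_neighbors_def)
  obtain f where f: "is_strategy G h g f"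
    and win: "\<And>c. c \<in> colorings h (pverts G) \<Longrightarrow>
      \<exists>x\<in>pverts G. c x \<in> f x (restrict c (out_neighbors G x))"
    using assms(3) unfolding winning_game_def by blast
  \<comment> \<open>No longer seeing \<open>v\<close>, the vertex \<open>u\<close> names every color it would have named
    for some color of \<open>v\<close>.\<close>
  define f' where
    "f' = (\<lambda>x s. if x = u then \<Union>k<h v. f u (s(v := k)) else f x s)"
  have "is_strategy (remove_arc G u v) h (g(u := g u * h v)) f'"
    unfolding is_strategy_def
  proof (intro ballI)
    fix x s
    assume x: "x \<in> pverts (remove_arc G u v)"
      and s: "s \<in> colorings h (out_neighbors (remove_arc G u v) x)"
    show "f' x s \<subseteq> {..<h x} \<and> card (f' x s) \<le> (g(u := g u * h v)) x"
    proof (cases "x = u")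
      case True
      have fu: "f u (s(v := k)) \<subseteq> {..<h u}" "card (f u (s(v := k))) \<le> g u"
        if "k < h v" for k
      proof -
        have "s(v := k) \<in> colorings h (out_neighbors G u)"
          using s True v(2) that by (simp add: out_neighbors_remove_arc colorings_fun_upd)
        then show "f u (s(v := k)) \<subseteq> {..<h u}" "card (f u (s(v := k))) \<le> g u"
          using f x True by (auto simp: is_strategy_def)
      qed
      have "card (\<Union>k<h v. f u (s(v := k))) \<le> (\<Sum>k<h v. card (f u (s(v := k))))"
        by (simp add: card_UN_le)
      also have "\<dots> \<le> g u * h v"
        using sum_bounded_above[of "{..<h v}" "\<lambda>k. card (f u (s(v := k)))" "g u"] fu(2)
        by (simp add: mult.commute)
      finally show ?thesis
        using True fu(1) by (auto simp: f'_def)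
    next
      case False
      then show ?thesis
        using f x s by (simp add: f'_def is_strategy_def out_neighbors_remove_arc)
    qed
  qed
  moreover have "\<exists>x\<in>pverts (remove_arc G u v).
      c x \<in> f' x (restrict c (out_neighbors (remove_arc G u v) x))"
    if c: "c \<in> colorings h (pverts (remove_arc G u v))" for c
  proof -
    obtain x where x: "x \<in> pverts G" "c x \<in> f x (restrict c (out_neighbors G x))"
      using win c by auto
    \<comment> \<open>The run with \<open>k = c v\<close> reproduces exactly what \<open>u\<close>
      saw in \<open>G\<close>, so a correct guess by \<open>u\<close> survives in the union.\<close>
    have "(restrict c (out_neighbors G u - {v}))(v := c v) = restrict c (out_neighbors G u)"
      using v(2) by (auto simp: fun_eq_iff)
    moreover have "c v < h v"
      using c v(1) by (auto simp: colorings_def)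
    ultimately have "c x \<in> f' x (restrict c (out_neighbors (remove_arc G u v) x))"
      using x(2) by (auto simp: f'_def out_neighbors_remove_arc intro!: bexI[of _ "c v"])
    with x(1) show ?thesis by auto
  qed
  ultimately show ?thesis
    unfolding winning_game_def by blast
qed

end
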